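(* Let $X$ be a Banach function space over a $\sigma$-finite measure space $(\Omega,\Sigma,\mu)$. Then any norm bounded positive increasing sequence in $X$ converges almost everywhere to a real-valued measurable function.
   Context: A Banach function space over a measure space $(\Omega,\Sigma,\mu)$ is an (order) ideal in $L_0(\Omega,\Sigma,\mu)$, the vector lattice of ($\mu$-a.e. equivalence classes of) real-valued measurable functions with the a.e. pointwise order, endowed with a complete lattice norm. A lattice norm is a norm with $\|x\|\le\|y\|$ whenever $|x|\le|y|$. "Real-valued" means that the limit is finite almost everywhere. *)

theory Defs
  imports "HOL-Analysis.Analysis"
begin

text \<open>
  Elements of \<open>L\<^sub>0(\<Omega>,\<Sigma>,\<mu>)\<close> are a.e. classes of measurable functions. As is usual for measure spaces
  \<open>M\<close> given by a term, we work with representatives: the elements are the functions in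
  \<open>borel_measurable M\<close>, and equality and order are the a.e. ones. A set of classes corresponds to a
  set of functions that is closed under a.e. equality (among measurable functions), and a norm on
  classes to a function that is constant on a.e. classes and vanishes exactly on the null functions.
\<close>

text \<open>
  Order ideal, that is, solid linear subspace, of \<open>L\<^sub>0\<close>. Solidity includes closure under a.e. equality.
\<close>

definition L0_ideal :: "'a measure \<Rightarrow> ('a \<Rightarrow> real) set \<Rightarrow> bool" where
  "L0_ideal M X \<longleftrightarrow>
     X \<subseteq> borel_measurable M \<and>
     (\<lambda>x. 0) \<in> X \<and>
     (\<forall>f\<in>X. \<forall>g\<in>X. (\<lambda>x. f x + g x) \<in> X) \<and>
     (\<forall>c. \<forall>f\<in>X. (\<lambda>x. c * f x) \<in> X) \<and>
     (\<forall>f\<in>X. \<forall>g\<in>borel_measurable M. (AE x in M. \<bar>g x\<bar> \<le> \<bar>f x\<bar>) \<longrightarrow> g \<in> X)"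

text \<open>
  The last clause (the lattice norm property) makes \<open>N\<close> constant on a.e. classes. The values of \<open>N\<close>
  outside \<open>X\<close> are irrelevant.
\<close>

definition lattice_norm_on :: "'a measure \<Rightarrow> ('a \<Rightarrow> real) set \<Rightarrow> (('a \<Rightarrow> real) \<Rightarrow> real) \<Rightarrow> bool" where
  "lattice_norm_on M X N \<longleftrightarrow>
     (\<forall>f\<in>X. 0 \<le> N f) \<and>
     (\<forall>f\<in>X. N f = 0 \<longleftrightarrow> (AE x in M. f x = 0)) \<and>
     (\<forall>c. \<forall>f\<in>X. N (\<lambda>x. c * f x) = \<bar>c\<bar> * N f) \<and>
     (\<forall>f\<in>X. \<forall>g\<in>X. N (\<lambda>x. f x + g x) \<le> N f + N g) \<and>
     (\<forall>f\<in>X. \<forall>g\<in>X. (AE x in M. \<bar>f x\<bar> \<le> \<bar>g x\<bar>) \<longrightarrow> N f \<le> N g)"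

definition norm_complete_on :: "('a \<Rightarrow> real) set \<Rightarrow> (('a \<Rightarrow> real) \<Rightarrow> real) \<Rightarrow> bool" where
  "norm_complete_on X N \<longleftrightarrow>
     (\<forall>u :: nat \<Rightarrow> 'a \<Rightarrow> real.
        (\<forall>n. u n \<in> X) \<and>
        (\<forall>e>0. \<exists>n0. \<forall>m\<ge>n0. \<forall>n\<ge>n0. N (\<lambda>x. u m x - u n x) < e)
        \<longrightarrow> (\<exists>f\<in>X. (\<lambda>n. N (\<lambda>x. u n x - f x)) \<longlonglongrightarrow> 0))"

definition banach_function_space ::
    "'a measure \<Rightarrow> ('a \<Rightarrow> real) set \<Rightarrow> (('a \<Rightarrow> real) \<Rightarrow> real) \<Rightarrow> bool" where
  "banach_function_space M X N \<longleftrightarrow>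
     L0_ideal M X \<and> lattice_norm_on M X N \<and> norm_complete_on X N"

end

theory Submission
  imports Defs
begin

text \<open>
  Only divergence to infinity on a non-null set has to be excluded, since an increasing sequence of
  reals converges unless it is unbounded. The difficulty is that the norm need not have the Fatou
  property: the truncations \<open>min (f n) k\<close> may increase to \<open>k\<close> on a set while their norms stay far
  below the norm of their supremum. So the norm bound cannot simply be passed to the pointwise
  supremum.

  An argument of Egorov type avoids this limit. If \<open>f n\<close> diverges on a non-null set, then by
  \<open>\<sigma>\<close>-finiteness it does so on a non-null set \<open>B\<close> of finite measure, and there the divergence can be
  made uniform: after removing a small part of \<open>B\<close>, a non-null set \<open>D\<close> is left such that every bound
  \<open>k\<close> is exceeded on the whole of \<open>D\<close> by a single member of the sequence
  (\<open>uniform_divergence_on_nonnull_subset\<close>). That member dominates \<open>k\<close> times the indicator of \<open>D\<close>, so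
  the norm of this indicator is at most \<open>C / k\<close> for every \<open>k\<close>. Hence it vanishes and \<open>D\<close> is null
  (\<open>null_set_if_norm_bounded_unbounded_below\<close>), a contradiction.
\<close>

text \<open>
  For fixed \<open>k\<close>, the parts of \<open>B\<close> where \<open>f n\<close> is still below \<open>k\<close> decrease to the empty set as \<open>n\<close>
  grows. As \<open>B\<close> has finite measure, their measures tend to \<open>0\<close>, so a suitable index \<open>m k\<close> leaves an
  exceptional set as small as desired, and the exceptional sets can be made summably small in \<open>k\<close>.
\<close>

lemma uniform_divergence_on_nonnull_subset:
  fixes f :: "nat \<Rightarrow> 'a \<Rightarrow> real"
  assumes B: "B \<in> sets M" "emeasure M B \<noteq> 0" "emeasure M B \<noteq> \<infinity>"
    and [measurable]: "\<And>n. f n \<in> borel_measurable M"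
    and inc: "\<And>x. x \<in> B \<Longrightarrow> incseq (\<lambda>n. f n x)"
    and unb: "\<And>x k. x \<in> B \<Longrightarrow> \<exists>n. real k \<le> f n x"
  obtains D m where "D \<in> sets M" "emeasure M D \<noteq> 0"
    "\<And>k x. x \<in> D \<Longrightarrow> real k \<le> f (m k) x"
proof -
  note [measurable] = B(1)
  define b where "b = measure M B"
  have eB: "emeasure M B = ennreal b"
    using B(3) by (simp add: b_def emeasure_eq_ennreal_measure top.not_eq_extremum)
  have b: "b > 0"
    using B(2) eB by (metis ennreal_eq_0_iff not_le)
  define E where "E k n = {x\<in>space M. x \<in> B \<and> f n x < real k}" for k n
  have E_sets [measurable]: "E k n \<in> sets M" for k n
    unfolding E_def by measurable
  have E_sub: "E k n \<subseteq> B" for k n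
    by (auto simp: E_def)
  have E_small: "\<exists>n. emeasure M (E k n) \<le> ennreal (b / 4 * (1/2)^k)" for k
  proof -
    have "(\<lambda>n. emeasure M (E k n)) \<longlonglongrightarrow> emeasure M (\<Inter>n. E k n)"
    proof (rule Lim_emeasure_decseq)
      show "range (E k) \<subseteq> sets M" by auto
      show "decseq (E k)"
        unfolding decseq_def E_def
        by (auto intro: le_less_trans[OF incseqD[OF inc]])
      show "emeasure M (E k n) \<noteq> \<infinity>" for n
        using emeasure_mono[OF E_sub B(1), of k n] B(3) by (auto simp: top_unique)
    qed
    moreover have "(\<Inter>n. E k n) = {}"
      using unb by (fastforce simp: E_def not_le[symmetric])
    ultimately have "(\<lambda>n. emeasure M (E k n)) \<longlonglongrightarrow> 0"
      by simp
    then have "\<forall>\<^sub>F n in sequentially. emeasure M (E k n) < ennreal (b / 4 * (1/2)^k)"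
      using b by (intro order_tendstoD(2)) auto
    then show ?thesis
      by (auto simp: eventually_sequentially intro: less_imp_le)
  qed
  then obtain m where m: "\<And>k. emeasure M (E k (m k)) \<le> ennreal (b / 4 * (1/2)^k)"
    by metis
  define U where "U = (\<Union>k. E k (m k))"
  have U_sets [measurable]: "U \<in> sets M"
    unfolding U_def by measurable
  have "emeasure M U \<le> (\<Sum>k. emeasure M (E k (m k)))"
    unfolding U_def by (rule emeasure_subadditive_countably) auto
  also have "\<dots> \<le> (\<Sum>k. ennreal (b / 4 * (1/2)^k))"
    using m by (intro suminf_le) auto
  also have "\<dots> = ennreal (b / 2)"
  proof (rule suminf_ennreal_eq)
    show "(\<lambda>k. b / 4 * (1/2)^k) sums (b / 2)"
      using sums_mult[OF geometric_sums[of "1/2::real"], of "b / 4"] by simp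
  qed (use b in auto)
  also have "\<dots> < emeasure M B"
    using b by (simp add: eB ennreal_less_iff)
  finally have less: "emeasure M U < emeasure M B" .
  show ?thesis
  proof
    show "B - U \<in> sets M" by measurable
    show "emeasure M (B - U) \<noteq> 0"
    proof
      assume "emeasure M (B - U) = 0"
      then have "emeasure M (U \<union> (B - U)) = emeasure M U"
        by (intro emeasure_Un_null_set) (auto simp: null_sets_def)
      then show False
        using less emeasure_mono[of B "U \<union> (B - U)" M] by auto
    qed
    show "real k \<le> f (m k) x" if x: "x \<in> B - U" for k x
    proof -
      have "x \<notin> E k (m k)" "x \<in> space M"
        using x sets.sets_into_space[OF B(1)] by (auto simp: U_def)
      then show ?thesis
        using x by (auto simp: E_def)
    qed
  qed
qed

text \<open>
  The norm of the indicator of \<open>D\<close> is squeezed to \<open>0\<close>, as \<open>k\<close> times it is at most \<open>C\<close> for every \<open>k\<close>.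
  That this indicator belongs to the ideal is the case \<open>k = 1\<close> of the domination.
\<close>

lemma null_set_if_norm_bounded_unbounded_below:
  assumes X: "L0_ideal M X" and N: "lattice_norm_on M X N"
    and D [measurable]: "D \<in> sets M"
    and h: "\<And>k :: nat. h k \<in> X" "\<And>k. N (h k) \<le> C"
      "\<And>k x. x \<in> D \<Longrightarrow> real k \<le> h k x"
  shows "emeasure M D = 0"
proof -
  let ?I = "indicator D :: _ \<Rightarrow> real"
  have solid: "g \<in> X"
    if "u \<in> X" "g \<in> borel_measurable M" "AE x in M. \<bar>g x\<bar> \<le> \<bar>u x\<bar>" for u g
    using X that unfolding L0_ideal_def by blast
  have dom: "\<bar>real k * ?I x\<bar> \<le> \<bar>h k x\<bar>" for k x
    using h(3)[of x k] by (auto simp: indicator_def)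
  have I: "?I \<in> X"
    using dom[of 1] by (intro solid[OF h(1)[of 1]]) auto
  have bound: "real k * N ?I \<le> C" for k
  proof -
    have kI: "(\<lambda>x. real k * ?I x) \<in> X"
      using dom by (intro solid[OF h(1)[of k]]) auto
    have "real k * N ?I = N (\<lambda>x. real k * ?I x)"
      using N I by (simp add: lattice_norm_on_def)
    also have "\<dots> \<le> N (h k)"
      using N kI h(1)[of k] dom[of k] unfolding lattice_norm_on_def by (meson AE_I2)
    finally show ?thesis
      using h(2)[of k] by simp
  qed
  have "\<not> N ?I > 0"
    using bound reals_Archimedean3[of "N ?I"] by (meson not_le)
  then have "N ?I = 0"
    using N I by (force simp: lattice_norm_on_def)
  then have "AE x in M. ?I x = 0"
    using N I by (simp add: lattice_norm_on_def)
  then have "AE x in M. x \<notin> D"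
    by eventually_elim (auto simp: indicator_def split: if_splits)
  then show ?thesis
    using AE_iff_null_sets[OF D] by auto
qed

lemma (in sigma_finite_measure) nonnull_subset_of_finite_measure:
  assumes A: "A \<in> sets M" "emeasure M A \<noteq> 0"
  obtains B where "B \<in> sets M" "B \<subseteq> A" "emeasure M B \<noteq> 0" "emeasure M B \<noteq> \<infinity>"
proof -
  obtain S :: "nat \<Rightarrow> 'a set" where S: "range S \<subseteq> sets M" "(\<Union>i. S i) = space M"
    "\<And>i. emeasure M (S i) \<noteq> \<infinity>"
    using sigma_finite by metis
  have "\<exists>i. emeasure M (A \<inter> S i) \<noteq> 0"
  proof (rule ccontr)
    assume "\<not> ?thesis"
    then have "(\<Union>i. A \<inter> S i) \<in> null_sets M"
      using A S(1) by (intro null_sets_UN) (auto simp: null_sets_def)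
    moreover have "(\<Union>i. A \<inter> S i) = A"
      using S(2) sets.sets_into_space[OF A(1)] by blast
    ultimately show False
      using A by auto
  qed
  then obtain i where i: "emeasure M (A \<inter> S i) \<noteq> 0" ..
  show ?thesis
  proof
    show "A \<inter> S i \<in> sets M" "A \<inter> S i \<subseteq> A" using A S(1) by auto
    show "emeasure M (A \<inter> S i) \<noteq> 0" by (fact i)
    show "emeasure M (A \<inter> S i) \<noteq> \<infinity>"
      using emeasure_mono[of "A \<inter> S i" "S i" M] S(1) S(3)[of i] by (auto simp: top_unique)
  qed
qed

theorem corollary2p5:
  fixes M :: "'a measure"
    and X :: "('a \<Rightarrow> real) set"
    and N :: "('a \<Rightarrow> real) \<Rightarrow> real"
    and f :: "nat \<Rightarrow> 'a \<Rightarrow> real"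
  assumes "sigma_finite_measure M"
    and "banach_function_space M X N"
    and "\<And>n. f n \<in> X"
    and "\<And>n. AE x in M. 0 \<le> f n x"
    and "\<And>m n. m \<le> n \<Longrightarrow> AE x in M. f m x \<le> f n x"
    and "\<exists>C. \<forall>n. N (f n) \<le> C"
  shows "\<exists>g\<in>borel_measurable M. AE x in M. (\<lambda>n. f n x) \<longlonglongrightarrow> g x"
proof -
  have X: "L0_ideal M X" and N: "lattice_norm_on M X N"
    using assms(2) by (auto simp: banach_function_space_def)
  have [measurable]: "f n \<in> borel_measurable M" for n
    using X assms(3) by (auto simp: L0_ideal_def)
  obtain C where C: "\<And>n. N (f n) \<le> C"
    using assms(6) by auto
  define A where
    "A = {x\<in>space M. (\<forall>n. f n x \<le> f (Suc n) x) \<and> (\<forall>k::nat. \<exists>n. real k \<le> f n x)}"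
  have A [measurable]: "A \<in> sets M"
    unfolding A_def by measurable
  have "emeasure M A = 0"
  proof (rule ccontr)
    assume "emeasure M A \<noteq> 0"
    then obtain B where B: "B \<in> sets M" "B \<subseteq> A" "emeasure M B \<noteq> 0" "emeasure M B \<noteq> \<infinity>"
      using sigma_finite_measure.nonnull_subset_of_finite_measure[OF assms(1) A] by metis
    have "incseq (\<lambda>n. f n x)" if "x \<in> B" for x
      using that B(2) by (intro incseq_SucI) (auto simp: A_def)
    moreover have "\<exists>n. real k \<le> f n x" if "x \<in> B" for x k
      using that B(2) by (auto simp: A_def)
    ultimately obtain D m where D: "D \<in> sets M" "emeasure M D \<noteq> 0"
      "\<And>k x. x \<in> D \<Longrightarrow> real k \<le> f (m k) x"
      by (rule uniform_divergence_on_nonnull_subset[OF B(1,3,4), of f, rotated]) auto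
    then have "emeasure M D = 0"
      using null_set_if_norm_bounded_unbounded_below[OF X N D(1), of "\<lambda>k. f (m k)" C]
        assms(3) C by auto
    with D(2) show False by simp
  qed
  then have "AE x in M. x \<notin> A"
    using AE_iff_null_sets[OF A] by auto
  moreover have "AE x in M. \<forall>n. f n x \<le> f (Suc n) x"
    unfolding AE_all_countable by (auto intro: assms(5))
  ultimately have "AE x in M. (\<lambda>n. f n x) \<longlonglongrightarrow> lim (\<lambda>n. f n x)"
    using AE_space
  proof eventually_elim
    fix x
    assume x: "x \<notin> A" "\<forall>n. f n x \<le> f (Suc n) x" "x \<in> space M"
    then obtain k :: nat where "\<And>n. f n x \<le> real k"
      by (auto simp: A_def not_le intro: less_imp_le)
    moreover have "incseq (\<lambda>n. f n x)"
      using x(2) by (auto intro: incseq_SucI)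
    ultimately show "(\<lambda>n. f n x) \<longlonglongrightarrow> lim (\<lambda>n. f n x)"
      by (metis incseq_convergent convergent_LIMSEQ_iff convergent_def)
  qed
  moreover have "(\<lambda>x. lim (\<lambda>n. f n x)) \<in> borel_measurable M"
    by measurable
  ultimately show ?thesis
    by (intro bexI[where x = "\<lambda>x. lim (\<lambda>n. f n x)"])
qed

end
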